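(* Let $(A,D)$ be a standard number system in $\mathbb{R}^m$. Then for any $x\in\mathbb{R}^m$ with a base $A$ expansion $x=\sum_{i=-\ell}^{\infty}A^{-i}d_i$ and every integer $n\ge 1$, $$(A-I)\sum_{i=0}^{n-1}\{A^i x\}=\sum_{i=1}^{n}d_i+\{A^n x\}-\{x\},$$ where the fractional parts are taken with respect to the given expansion of $x$ and the induced (shifted) expansions of $A^i x$.
   Context: A standard number system $(A,D)$ in $\mathbb{R}^m$ consists of an $m\times m$ matrix $A$ with integer entries that is expanding (all eigenvalues have modulus greater than 1) and a digit set $D\subset\mathbb{Z}^m$ of cardinality $q=|\det A|$ containing exactly one element of each coset of $A\mathbb{Z}^m$ in $\mathbb{Z}^m$, with $0\in D$. A base $A$ expansion of $x\in\mathbb{R}^m$ is a representation $x=\sum_{i=-\ell}^{\infty}A^{-i}d_i$ with $\ell$ an integer, all $d_i\in D$ and $d_{-\ell}\neq 0$ (the series converges because $A$ is expanding); set $d_i=0$ for $i<-\ell$. An expansion need not be unique. The fractional part, which depends on the chosen expansion, is $\{x\}=\sum_{i=1}^{\infty}A^{-i}d_i$. For $i\ge 0$, $A^i x$ is given the expansion obtained by shifting digits, $A^i x=\sum_{j=-\ell}^{\infty}A^{-(j-i)}d_j$, so that $\{A^i x\}=\sum_{j=1}^{\infty}A^{-j}d_{i+j}$. $I$ is the identity matrix. *)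

theory Defs
  imports "HOL-Analysis.Analysis"
begin

definition int_vecs :: "(real ^ 'm) set" where
  "int_vecs = {v. \<forall>i. v $ i \<in> \<int>}"

definition integer_matrix :: "real ^ 'm ^ 'm \<Rightarrow> bool" where
  "integer_matrix A \<longleftrightarrow> (\<forall>i j. A $ i $ j \<in> \<int>)"

definition eigenvalue :: "complex ^ 'm ^ 'm \<Rightarrow> complex \<Rightarrow> bool" where
  "eigenvalue B c \<longleftrightarrow> (\<exists>v. v \<noteq> 0 \<and> B *v v = c *s v)"

text \<open>The eigenvalues of a real matrix are taken over the complex numbers.\<close>

definition expanding :: "real ^ 'm ^ 'm \<Rightarrow> bool" where
  "expanding A \<longleftrightarrow> (\<forall>c. eigenvalue (map_matrix complex_of_real A) c \<longrightarrow> norm c > 1)"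

definition standard_number_system :: "real ^ 'm ^ 'm \<Rightarrow> (real ^ 'm) set \<Rightarrow> bool" where
  "standard_number_system A D \<longleftrightarrow>
     integer_matrix A \<and> expanding A \<and>
     D \<subseteq> int_vecs \<and> finite D \<and> real (card D) = \<bar>det A\<bar> \<and>
     (\<forall>z\<in>int_vecs. \<exists>!d. d \<in> D \<and> d \<in> (\<lambda>y. z + A *v y) ` int_vecs) \<and>
     0 \<in> D"

text \<open>Matrix powers are defined from \<open>**\<close> because the power operator \<open>^\<close> on
  the type \<open>real ^ 'm ^ 'm\<close> is componentwise.\<close>

primrec mat_power :: "real ^ 'm ^ 'm \<Rightarrow> nat \<Rightarrow> real ^ 'm ^ 'm" where
  "mat_power A 0 = mat 1"
| "mat_power A (Suc n) = A ** mat_power A n"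

definition mat_zpower :: "real ^ 'm ^ 'm \<Rightarrow> int \<Rightarrow> real ^ 'm ^ 'm" where
  "mat_zpower A k =
     (if k \<ge> 0 then mat_power A (nat k) else mat_power (matrix_inv A) (nat (- k)))"

text \<open>\<open>base_expansion A D x l d\<close>: the series of \<open>A\<^sup>-\<^sup>i d\<^sub>i\<close> over all \<open>i \<ge> - l\<close> is a base \<open>A\<close>
  expansion of \<open>x\<close>. The series is indexed by naturals through \<open>i = k - l\<close>. The digit
  sequence is extended by \<open>0\<close> to all integers, and \<open>l\<close> may be negative.\<close>

definition base_expansion ::
    "real ^ 'm ^ 'm \<Rightarrow> (real ^ 'm) set \<Rightarrow> real ^ 'm \<Rightarrow> int \<Rightarrow> (int \<Rightarrow> real ^ 'm) \<Rightarrow> bool" where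
  "base_expansion A D x l d \<longleftrightarrow>
     (\<forall>i \<ge> - l. d i \<in> D) \<and> d (- l) \<noteq> 0 \<and> (\<forall>i < (- l). d i = 0) \<and>
     (\<lambda>k. mat_zpower A (- (int k - l)) *v d (int k - l)) sums x"

text \<open>The fractional part depends on the chosen expansion, so it is a function of the
  digit sequence.\<close>

definition frac_part :: "real ^ 'm ^ 'm \<Rightarrow> (int \<Rightarrow> real ^ 'm) \<Rightarrow> real ^ 'm" where
  "frac_part A d = (\<Sum>k. mat_zpower A (- int (Suc k)) *v d (int (Suc k)))"

definition shift_digits :: "nat \<Rightarrow> (int \<Rightarrow> real ^ 'm) \<Rightarrow> int \<Rightarrow> real ^ 'm" where
  "shift_digits n d = (\<lambda>j. d (j + int n))"

lemma frac_part_shift_digits: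
  "frac_part A (shift_digits n d) =
     (\<Sum>k. mat_zpower A (- int (Suc k)) *v d (int n + int (Suc k)))"
  by (simp add: frac_part_def shift_digits_def add.commute)

lemma expanding_invertible:
  fixes A :: "real ^ 'm ^ 'm"
  assumes "expanding A"
  shows "invertible A"
proof (rule ccontr)
  assume "\<not> invertible A"
  then obtain v where v: "A *v v = 0" "v \<noteq> 0"
    by (auto simp: invertible_left_inverse matrix_left_invertible_ker)
  define w :: "complex ^ 'm" where "w = (\<chi> i. complex_of_real (v $ i))"
  have "w \<noteq> 0" using v(2) by (auto simp: w_def vec_eq_iff)
  moreover have "map_matrix complex_of_real A *v w = 0 *s w"
  proof -
    have "(map_matrix complex_of_real A *v w) $ i = complex_of_real ((A *v v) $ i)" for i
      by (simp add: matrix_vector_mult_def w_def)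
    then show ?thesis by (simp add: vec_eq_iff v(1))
  qed
  ultimately have "eigenvalue (map_matrix complex_of_real A) 0"
    unfolding eigenvalue_def by blast
  with assms show False by (auto simp: expanding_def)
qed

lemma mat_zpower_Suc:
  fixes A :: "real ^ 'm ^ 'm"
  assumes "invertible A"
  shows "mat_zpower A (k + 1) = A ** mat_zpower A k"
proof (cases "k \<ge> 0")
  case True
  then show ?thesis by (simp add: mat_zpower_def nat_add_distrib)
next
  case False
  then obtain j where j: "k = - int (Suc j)"
    by (metis int_cases linorder_not_le of_nat_0_le_iff)
  have inv: "A ** matrix_inv A = mat 1"
    using assms someI_ex[of "\<lambda>B. A ** B = mat 1 \<and> B ** A = mat 1"]
    by (simp add: invertible_def matrix_inv_def)
  then have "A ** (matrix_inv A ** B) = B" for B :: "real ^ 'm ^ 'm"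
    by (simp add: matrix_mul_assoc)
  then show ?thesis
    by (cases j) (simp_all add: j inv mat_zpower_def nat_add_distrib)
qed

lemma mat_zpower_add:
  fixes A :: "real ^ 'm ^ 'm"
  assumes "invertible A"
  shows "mat_zpower A (int n + k) = mat_power A n ** mat_zpower A k"
proof (induction n)
  case (Suc n)
  then show ?case
    using mat_zpower_Suc[OF assms, of "int n + k"]
    by (simp add: algebra_simps matrix_mul_assoc)
qed simp

text \<open>The shifted digits form an expansion of \<open>A\<^sup>n x\<close>, and the series defining the
  fractional part of an expansion converges.\<close>

lemma base_expansion_shift_digits:
  fixes A :: "real ^ 'm ^ 'm"
  assumes "standard_number_system A D" "base_expansion A D x l d"
  shows "base_expansion A D (mat_power A n *v x) (l + int n) (shift_digits n d)"
proof -
  have inv: "invertible A"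
    using assms(1) expanding_invertible by (auto simp: standard_number_system_def)
  have "(\<lambda>k. mat_zpower A (- (int k - l)) *v d (int k - l)) sums x"
    using assms(2) by (simp add: base_expansion_def)
  from bounded_linear.sums[OF matrix_vector_mul_bounded_linear this, of "mat_power A n"]
  have "(\<lambda>k. mat_zpower A (int n + (- (int k - l))) *v d (int k - l)) sums (mat_power A n *v x)"
    by (simp only: mat_zpower_add[OF inv] matrix_vector_mul_assoc)
  then show ?thesis
    using assms(2) by (simp add: base_expansion_def shift_digits_def algebra_simps)
qed

lemma frac_part_sums:
  assumes "base_expansion A D x l d"
  shows "(\<lambda>k. mat_zpower A (- int (Suc k)) *v d (int (Suc k))) sums frac_part A d"
proof -
  define g where "g = (\<lambda>i. mat_zpower A (- i) *v d i)"
  have s: "summable (\<lambda>k. g (int k - l))"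
    using assms by (auto simp: base_expansion_def g_def dest: sums_summable)
  have "summable (\<lambda>k. g (int (Suc k)))"
  proof (cases "l \<ge> 0")
    case True
    have "summable (\<lambda>k. g (int (k + nat (l + 1)) - l))"
      using s by (subst summable_iff_shift[where f = "\<lambda>k. g (int k - l)"])
    with True show ?thesis by (simp add: algebra_simps)
  next
    case False
    have "(\<lambda>k. g (int (Suc (k + nat (- l - 1))))) = (\<lambda>k. g (int k - l))"
      using False by (simp add: algebra_simps)
    with s show ?thesis
      using summable_iff_shift[where f = "\<lambda>k. g (int (Suc k))" and k = "nat (- l - 1)"] by simp
  qed
  then show ?thesis by (simp add: frac_part_def g_def summable_sums)
qed

end

theory Submission
  imports Defs
begin

text \<open>
  Multiplication by \<open>A\<close> moves the radix point one place to the right, so it turns the first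
  fractional digit into an integer digit and leaves a fractional part made of the remaining
  digits: \<open>A {x} = d\<^sub>1 + {A x}\<close> (lemma \<open>mult_frac_part\<close>). Every \<open>A\<^sup>i x\<close> carries its own shifted
  expansion, hence \<open>(A - I) {A\<^sup>i x} = d\<^sub>i\<^sub>+\<^sub>1 + {A\<^sup>i\<^sup>+\<^sup>1 x} - {A\<^sup>i x}\<close>. Summing over \<open>i\<close>, the
  differences of fractional parts telescope and the digits accumulate.
\<close>

lemma shift_digits_Suc: "shift_digits (Suc i) d = shift_digits 1 (shift_digits i d)"
  by (simp add: shift_digits_def algebra_simps)

text \<open>
  The series for \<open>{x}\<close> converges, so \<open>A\<close> may be applied term by term. This raises every
  exponent by one: the leading term becomes \<open>A\<^sup>0 d\<^sub>1 = d\<^sub>1\<close>, and the other terms form the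
  series for the fractional part of the shifted expansion.
\<close>

lemma mult_frac_part:
  fixes A :: "real ^ 'm ^ 'm"
  assumes "invertible A" "base_expansion A D x l d"
  shows "A *v frac_part A d = d 1 + frac_part A (shift_digits 1 d)"
proof -
  define g where "g = (\<lambda>k. mat_zpower A (- int k) *v d (int (Suc k)))"
  have shift: "A ** mat_zpower A (- int (Suc k)) = mat_zpower A (- int k)" for k
    using mat_zpower_Suc[OF assms(1), of "- int (Suc k)"] by simp
  have "(\<lambda>k. A *v (mat_zpower A (- int (Suc k)) *v d (int (Suc k)))) sums (A *v frac_part A d)"
    by (rule bounded_linear.sums[OF matrix_vector_mul_bounded_linear frac_part_sums[OF assms(2)]])
  then have g: "g sums (A *v frac_part A d)"
    by (simp only: matrix_vector_mul_assoc shift g_def)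
  have "g 0 = d 1"
    by (simp add: g_def mat_zpower_def)
  moreover have "(\<Sum>k. g (Suc k)) = frac_part A (shift_digits 1 d)"
    by (simp add: g_def frac_part_def shift_digits_def algebra_simps)
  ultimately show ?thesis
    using suminf_split_head[OF sums_summable[OF g]] sums_unique[OF g] by (simp add: algebra_simps)
qed

theorem theorem3p3:
  fixes A :: "real ^ 'm ^ 'm" and D :: "(real ^ 'm) set"
    and x :: "real ^ 'm" and l :: int and d :: "int \<Rightarrow> real ^ 'm" and n :: nat
  assumes "standard_number_system A D"
    and "base_expansion A D x l d"
    and "n \<ge> 1"
  shows "(A - mat 1) *v (\<Sum>i=0..n-1. frac_part A (shift_digits i d)) =
         (\<Sum>i=1..n. d (int i)) + frac_part A (shift_digits n d) - frac_part A d"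
proof -
  define f where "f i = frac_part A (shift_digits i d)" for i
  have inv: "invertible A"
    using assms(1) expanding_invertible by (auto simp: standard_number_system_def)
  have step: "(A - mat 1) *v f i = d (int (Suc i)) + (f (Suc i) - f i)" for i
  proof -
    have "A *v f i = shift_digits i d 1 + f (Suc i)"
      unfolding f_def shift_digits_Suc
      by (rule mult_frac_part[OF inv base_expansion_shift_digits[OF assms(1,2)]])
    then show ?thesis
      by (simp add: matrix_vector_mult_diff_rdistrib shift_digits_def)
  qed
  have "{0..n-1} = {..<n}"
    using assms(3) by auto
  then have "(A - mat 1) *v (\<Sum>i=0..n-1. f i) = (\<Sum>i<n. (A - mat 1) *v f i)"
    by (simp add: linear_sum)
  also have "\<dots> = (\<Sum>i<n. d (int (Suc i))) + (f n - f 0)"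
    by (simp only: step sum.distrib sum_lessThan_telescope)
  also have "(\<Sum>i<n. d (int (Suc i))) = (\<Sum>i=1..n. d (int i))"
    using sum.atLeast1_atMost_eq[of "\<lambda>i. d (int i)" n] by simp
  finally show ?thesis
    by (simp add: f_def shift_digits_def)
qed

end
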